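(* Let $\mathcal{A}$ be an adequate family of subsets of $\mathbb{N}$ and let $1 < p < \infty$. Then (i) $h_{\mathcal{A},p}$ does not have delta-points; (ii) the dual space $h_{\mathcal{A},p}^*$ does not have delta-points.
   Context: All Banach spaces are real. $B_X$, $S_X$, $X^*$ denote the closed unit ball, unit sphere and topological dual of a Banach space $X$. Adequate family: a family $\mathcal{A}$ of subsets of $\mathbb{N}=\{1,2,\dots\}$ is adequate if (1) it contains the empty set and all singletons $\{i\}$, $i\in\mathbb{N}$; (2) it is hereditary: $A\in\mathcal{A}$ and $B\subseteq A$ imply $B\in\mathcal{A}$; (3) it is compact for pointwise convergence, i.e. given $A\subset\mathbb{N}$, if every finite subset of $A$ is in $\mathcal{A}$, then $A\in\mathcal{A}$. The space $h_{\mathcal{A},p}$ ($1\le p<\infty$): the completion of the space $c_{00}$ of finitely supported sequences, with standard basis $(e_i)_{i\in\mathbb{N}}$, in the norm $\left\|\sum_{i=1}^n a_i e_i\right\| = \sup_{A\in\mathcal{A}}\left(\sum_{i\in A}|a_i|^p\right)^{1/p}$ (with $a_i=0$ for $i>n$). Slices: for $x^*\in S_{X^*}$ and $\delta>0$, $S(x^*,\delta)=\{x\in B_X : x^*(x)>1-\delta\}$. Delta-point: $x\in S_X$ is a delta-point of $X$ if for every slice $S(x^*,\delta)$ of $B_X$ with $x\in S(x^*,\delta)$ and every $\varepsilon>0$ there exists $y\in S(x^*,\delta)$ with $\|x-y\|\ge 2-\varepsilon$. *)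

theory Defs
  imports "HOL-Analysis.Analysis"
begin

text \<open>The index set is \<open>{1..}\<close>, so that members of an adequate family never contain \<open>0\<close>.\<close>

definition adequate :: "nat set set \<Rightarrow> bool" where
  "adequate \<A> \<longleftrightarrow>
     \<A> \<subseteq> Pow {1..} \<and>
     {} \<in> \<A> \<and> (\<forall>i\<ge>1. {i} \<in> \<A>) \<and>
     (\<forall>A B. A \<in> \<A> \<longrightarrow> B \<subseteq> A \<longrightarrow> B \<in> \<A>) \<and>
     (\<forall>A\<subseteq>{1..}. (\<forall>F. F \<subseteq> A \<longrightarrow> finite F \<longrightarrow> F \<in> \<A>) \<longrightarrow> A \<in> \<A>)"

text \<open>The norm of \<open>\<Sum>i=1..n. a i *\<^sub>R e i\<close>. Only \<open>a 1, \<dots>, a n\<close> matter, the coefficients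
  beyond \<open>n\<close> being read as zero; this makes every inner sum finite.\<close>

definition c00_norm :: "nat set set \<Rightarrow> real \<Rightarrow> nat \<Rightarrow> (nat \<Rightarrow> real) \<Rightarrow> real" where
  "c00_norm \<A> p n a = (SUP A\<in>\<A>. (\<Sum>i\<in>A \<inter> {1..n}. \<bar>a i\<bar> powr p) powr (1 / p))"

lemma bdd_above_c00_norm:
  fixes a :: "nat \<Rightarrow> real"
  assumes "0 < p"
  shows "bdd_above ((\<lambda>A. (\<Sum>i\<in>A \<inter> {1..n}. \<bar>a i\<bar> powr p) powr (1 / p)) ` \<A>)"
proof (rule bdd_aboveI2)
  fix A
  show "(\<Sum>i\<in>A \<inter> {1..n}. \<bar>a i\<bar> powr p) powr (1 / p)
      \<le> (\<Sum>i\<in>{1..n}. \<bar>a i\<bar> powr p) powr (1 / p)"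
    using assms by (intro powr_mono2[OF _ sum_nonneg sum_mono2]) auto
qed

text \<open>The completion of \<open>c\<^sub>0\<^sub>0\<close> is determined up to isometric isomorphism: the Banach space
  \<open>'a\<close> is that completion when it receives a linear isometric copy of the normed space
  \<open>c\<^sub>0\<^sub>0\<close> with dense range. A linear map on \<open>c\<^sub>0\<^sub>0\<close> is given by the images \<open>e i\<close>, \<open>i \<ge> 1\<close>, of
  the standard basis; the value \<open>e 0\<close> plays no role.\<close>

definition is_h_space :: "nat set set \<Rightarrow> real \<Rightarrow> (nat \<Rightarrow> 'a::banach) \<Rightarrow> bool" where
  "is_h_space \<A> p e \<longleftrightarrow>
     (\<forall>n a. norm (\<Sum>i=1..n. a i *\<^sub>R e i) = c00_norm \<A> p n a) \<and>
     closure (span (e ` {1..})) = UNIV"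

definition slice :: "('a::real_normed_vector \<Rightarrow>\<^sub>L real) \<Rightarrow> real \<Rightarrow> 'a set" where
  "slice f \<delta> = {x \<in> cball 0 1. blinfun_apply f x > 1 - \<delta>}"

definition delta_point :: "'a::real_normed_vector \<Rightarrow> bool" where
  "delta_point x \<longleftrightarrow> x \<in> sphere 0 1 \<and>
     (\<forall>f\<in>sphere 0 1. \<forall>\<delta>>0. x \<in> slice f \<delta> \<longrightarrow>
        (\<forall>\<epsilon>>0. \<exists>y\<in>slice f \<delta>. norm (x - y) \<ge> 2 - \<epsilon>))"

end

theory Submission imports Defs begin

text \<open>
  A delta-point \<open>x\<close> may be tested on slices that are not close to being normed by \<open>x\<close>: every
  open half-space containing \<open>x\<close> contains points of the unit ball almost antipodal to \<open>x\<close>.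

  Dual space: if \<open>f\<close> is a delta-point, choose \<open>i\<close> with \<open>f (e i) \<noteq> 0\<close> and use the half-space given by
  evaluation at \<open>\<plusminus> e i\<close>. If \<open>g\<close> in it is almost antipodal to \<open>f\<close>, take \<open>y\<close> in the ball with
  \<open>f y \<approx> 1\<close> and \<open>g y \<approx> -1\<close>. Reflecting the \<open>i\<close>-th coordinate of \<open>y\<close> shows that it is almost \<open>0\<close>, so
  \<open>y \<plusminus> s e i\<close> has norm about \<open>(1 + s\<^sup>p)\<^sup>1\<^sup>/\<^sup>p\<close>, whereas the value of \<open>f\<close> grows linearly in \<open>s\<close>.

  The space itself: given \<open>x\<close>, let \<open>N\<close> be such that \<open>x\<close> is small beyond \<open>N\<close>. Only finitely many sets
  \<open>t \<subseteq> {1..N}\<close> are traces of sets that almost norm \<open>x\<close>; the sum of one almost norming functional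
  per such \<open>t\<close> defines the half-space. If \<open>y\<close> in it is almost antipodal to \<open>x\<close> as witnessed by \<open>B\<close>,
  then \<open>B\<close> almost norms \<open>x\<close>, and the functional chosen for the trace of \<open>B\<close> collects almost nothing
  positive from \<open>y\<close> on that trace. Its value at \<open>y\<close> is thus far from \<open>1\<close>, although each summand
  must be close to \<open>1\<close>.
\<close>

section \<open>Half-spaces, norming vectors and extension by density\<close>

text \<open>Dividing \<open>h\<close> by its norm turns the half-space into a slice; for
  \<open>h = 0\<close> the point \<open>- x\<close> works. Functionals can thus be used
  unnormalised, without first checking that they are nonzero.\<close>

lemma delta_point_halfspace:
  fixes x :: "'b::real_normed_vector" and h :: "'b \<Rightarrow>\<^sub>L real"
  assumes x: "delta_point x" and c: "c < h x" and "0 < \<epsilon>"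
  obtains y where "norm y \<le> 1" "c < h y" "2 - \<epsilon> \<le> norm (x - y)"
proof (cases "h = 0")
  case True
  have "norm x = 1" using x by (simp add: delta_point_def)
  moreover have "norm (x - (- x)) = 2 * norm x"
    by (metis diff_minus_eq_add mult_2 norm_scaleR scaleR_2 abs_numeral)
  ultimately show ?thesis using True c \<open>0 < \<epsilon>\<close> by (intro that[of "- x"]) auto
next
  case False
  define k where "k = norm h"
  have k: "0 < k" using False by (simp add: k_def)
  have "norm x = 1" using x by (simp add: delta_point_def)
  then have "h x \<le> k" using norm_blinfun[of h x] by (simp add: k_def)
  define f where "f = (1 / k) *\<^sub>R h"
  define \<delta> where "\<delta> = 1 - c / k"
  have "f \<in> sphere 0 1" using k by (simp add: f_def k_def)
  moreover have "0 < \<delta>" using c \<open>h x \<le> k\<close> k by (simp add: \<delta>_def)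
  moreover have slice: "y \<in> slice f \<delta> \<longleftrightarrow> norm y \<le> 1 \<and> c < h y" for y
    using k by (simp add: slice_def f_def \<delta>_def scaleR_blinfun.rep_eq divide_simps)
  moreover have "x \<in> slice f \<delta>" using slice c \<open>norm x = 1\<close> by simp
  ultimately obtain y where "y \<in> slice f \<delta>" "2 - \<epsilon> \<le> norm (x - y)"
    using x \<open>0 < \<epsilon>\<close> unfolding delta_point_def by blast
  then show ?thesis using slice that by blast
qed

lemma blinfun_near_norm:
  fixes h :: "'b::real_normed_vector \<Rightarrow>\<^sub>L real"
  assumes "0 \<le> r" "r < norm h"
  obtains y where "norm y \<le> 1" "r < h y"
proof -
  obtain y where y: "r * norm y < \<bar>h y\<bar>"
    using assms norm_blinfun_bound[of r h] by (metis not_le real_norm_def)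
  then have "y \<noteq> 0" by auto
  let ?y = "(sgn (h y) / norm y) *\<^sub>R y"
  have "norm ?y \<le> 1" using \<open>y \<noteq> 0\<close> by (simp add: abs_sgn_eq)
  moreover have hy: "h ?y = \<bar>h y\<bar> / norm y"
    by (simp add: blinfun.scaleR_right sgn_mult_self_eq abs_sgn mult.commute)
  have "r < h ?y" unfolding hy using y \<open>y \<noteq> 0\<close> by (simp add: field_simps)
  ultimately show ?thesis using that by blast
qed

text \<open>The bound makes \<open>\<phi>\<close> uniformly continuous on \<open>V\<close>.
  Linearity and the bound are closed conditions, so the continuous extension inherits them. As
  \<open>\<phi>\<close> is not controlled off \<open>V\<close>, \<open>g\<close> may differ from it
  there.\<close>

lemma dense_linear_extension:
  fixes \<phi> :: "'a::real_normed_vector \<Rightarrow> real"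
  assumes lin: "linear \<phi>" and sub: "subspace V" and dense: "closure V = UNIV"
    and bound: "\<And>x. x \<in> V \<Longrightarrow> \<bar>\<phi> x\<bar> \<le> norm x"
  obtains g :: "'a \<Rightarrow>\<^sub>L real" where "\<And>x. x \<in> V \<Longrightarrow> g x = \<phi> x"
proof -
  interpret linear \<phi> by (fact lin)
  have "uniformly_continuous_on V \<phi>"
    unfolding uniformly_continuous_on_def
  proof (intro allI impI)
    fix \<epsilon> :: real assume "0 < \<epsilon>"
    show "\<exists>d>0. \<forall>x\<in>V. \<forall>x'\<in>V. dist x' x < d \<longrightarrow> dist (\<phi> x') (\<phi> x) < \<epsilon>"
    proof (intro exI[of _ \<epsilon>] conjI ballI impI \<open>0 < \<epsilon>\<close>)
      fix x x' assume "x \<in> V" "x' \<in> V" "dist x' x < \<epsilon>"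
      then show "dist (\<phi> x') (\<phi> x) < \<epsilon>"
        using bound[OF subspace_diff[OF sub]] by (force simp: dist_norm diff[symmetric])
    qed
  qed
  then obtain g where g: "uniformly_continuous_on (closure V) g" "\<And>x. x \<in> V \<Longrightarrow> \<phi> x = g x"
    using uniformly_continuous_on_extension_on_closure by metis
  then have cont: "continuous_on UNIV g"
    using dense uniformly_continuous_imp_continuous by metis
  have cont': "continuous_on UNIV (\<lambda>x. g (t x))" if "continuous_on UNIV t" for t :: "'c::topological_space \<Rightarrow> 'a"
    using continuous_on_compose2[OF cont that] by simp
  have "closed {z. g (fst z + snd z) = g (fst z) + g (snd z)}"
    by (intro closed_Collect_eq continuous_intros cont')
  moreover have "V \<times> V \<subseteq> {z. g (fst z + snd z) = g (fst z) + g (snd z)}"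
  proof clarify
    fix x y assume "x \<in> V" "y \<in> V"
    then show "g (fst (x, y) + snd (x, y)) = g (fst (x, y)) + g (snd (x, y))"
      using g(2)[of x] g(2)[of y] g(2)[of "x + y"] subspace_add[OF sub] add[of x y] by simp
  qed
  ultimately have "closure (V \<times> V) \<subseteq> {z. g (fst z + snd z) = g (fst z) + g (snd z)}"
    by (rule closure_minimal[rotated])
  moreover have "closure (V \<times> V) = UNIV" using dense by (simp add: closure_Times)
  ultimately have "g (fst z + snd z) = g (fst z) + g (snd z)" for z by blast
  then have 1: "g (x + y) = g x + g y" for x y by (metis fst_conv snd_conv)
  have "closed {x. g (r *\<^sub>R x) = r *\<^sub>R g x}" for r
    by (intro closed_Collect_eq continuous_intros cont' cont)
  moreover have "V \<subseteq> {x. g (r *\<^sub>R x) = r *\<^sub>R g x}" for r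
  proof clarify
    fix x assume "x \<in> V"
    then show "g (r *\<^sub>R x) = r *\<^sub>R g x"
      using g(2)[of x] g(2)[of "r *\<^sub>R x"] subspace_scale[OF sub] scale[of r x] by simp
  qed
  ultimately have 2: "g (r *\<^sub>R x) = r *\<^sub>R g x" for r x
    using closure_minimal[of V "{x. g (r *\<^sub>R x) = r *\<^sub>R g x}"] dense by blast
  have "closed {x. \<bar>g x\<bar> \<le> norm x}"
    by (intro closed_Collect_le continuous_intros cont)
  moreover have "V \<subseteq> {x. \<bar>g x\<bar> \<le> norm x}" using bound g(2) by force
  ultimately have 3: "norm (g x) \<le> norm x * 1" for x
    using closure_minimal[of V "{x. \<bar>g x\<bar> \<le> norm x}"] dense by auto
  have "bounded_linear g" by (rule bounded_linear_intro[OF 1 2 3])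
  then show ?thesis using g(2) that[of "Blinfun g"] by (simp add: bounded_linear_Blinfun_apply)
qed

section \<open>Scalar inequalities for p-th powers\<close>

lemma young_powr:
  fixes a b p :: real
  assumes "1 < p" "0 \<le> a" "0 \<le> b"
  shows "a powr (p - 1) * b \<le> (1 - 1 / p) * a powr p + b powr p / p"
proof (cases "a = 0 \<or> b = 0")
  case True
  then show ?thesis using assms by auto
next
  case False
  then have ab: "0 < a" "0 < b" using assms by auto
  have "(a powr p) powr (1 - 1 / p) * (b powr p) powr (1 / p) \<le> (1 - 1 / p) * a powr p + 1 / p * b powr p"
    using ab assms by (intro Youngs_inequality_0) auto
  moreover have "p * (1 - 1 / p) = p - 1" using assms by (simp add: field_simps)
  ultimately show ?thesis using ab assms by (simp add: powr_powr)
qed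

text \<open>Triangle inequality, then convexity of the \<open>p\<close>-th power at the midpoint of
  the two absolute values.\<close>

lemma abs_diff_powr_le:
  fixes a b p :: real
  assumes p: "1 < p"
  shows "\<bar>a - b\<bar> powr p \<le> 2 powr (p - 1) * (\<bar>a\<bar> powr p + \<bar>b\<bar> powr p)"
proof (cases "a = 0 \<or> b = 0")
  case True
  have "1 * t \<le> 2 powr (p - 1) * t" if "0 \<le> t" for t :: real
    using p that by (intro mult_right_mono) (simp_all add: ge_one_powr_ge_zero)
  then show ?thesis using True by auto
next
  case False
  have "\<bar>a - b\<bar> powr p \<le> (\<bar>a\<bar> + \<bar>b\<bar>) powr p"
    using p by (intro powr_mono2) auto
  also have "\<dots> = 2 powr p * ((1/2) * \<bar>a\<bar> + (1/2) * \<bar>b\<bar>) powr p"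
    by (subst powr_mult[symmetric]) (auto simp: algebra_simps)
  also have "\<dots> \<le> 2 powr p * ((1/2) * \<bar>a\<bar> powr p + (1/2) * \<bar>b\<bar> powr p)"
    using convex_onD[OF powr_convex[of p], of "1/2" "\<bar>a\<bar>" "\<bar>b\<bar>"] False p by simp
  also have "\<dots> = 2 powr (p - 1) * (\<bar>a\<bar> powr p + \<bar>b\<bar> powr p)"
    by (simp add: powr_diff algebra_simps)
  finally show ?thesis .
qed

lemma sgn_mult_le: "sgn a * b \<le> \<bar>b\<bar>" for a b :: real
  by (auto simp: sgn_if)

text \<open>The right-hand side measures how far \<open>a\<close> and \<open>b\<close> are from being antipodal.\<close>

lemma powr_antipodal_gap:
  fixes a b p :: real
  assumes p: "1 < p"
  shows "(2 powr (p - 1) - 1) * (\<bar>a\<bar> powr (p - 1) * sgn a * b)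
    \<le> 2 powr (p - 1) * (\<bar>a\<bar> powr p + \<bar>b\<bar> powr p) - \<bar>a - b\<bar> powr p"
proof -
  have K: "1 < 2 powr (p - 1)" using p by simp
  show ?thesis
  \<comment> \<open>Without opposite signs, \<open>\<bar>a - b\<bar>\<close> is at most the larger
    absolute value, so the right-hand side keeps a multiple of the sum of the powers, and Young's
    inequality bounds the product by that sum. With opposite signs the left-hand side is nonpositive
    and the right-hand side nonnegative.\<close>
  proof (cases "0 \<le> sgn a * b")
    case True
    have "\<bar>a - b\<bar> \<le> max \<bar>a\<bar> \<bar>b\<bar>"
      using True by (auto simp: sgn_if split: if_splits)
    then have "\<bar>a - b\<bar> powr p \<le> max \<bar>a\<bar> \<bar>b\<bar> powr p"
      using p by (intro powr_mono2) auto
    also have "\<dots> \<le> \<bar>a\<bar> powr p + \<bar>b\<bar> powr p" by (auto simp: max_def)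
    finally have 1: "\<bar>a - b\<bar> powr p \<le> \<bar>a\<bar> powr p + \<bar>b\<bar> powr p" .
    have "\<bar>a\<bar> powr (p - 1) * sgn a * b \<le> \<bar>a\<bar> powr (p - 1) * \<bar>b\<bar>"
      unfolding mult.assoc by (intro mult_left_mono sgn_mult_le) simp
    also have "\<dots> \<le> (1 - 1 / p) * \<bar>a\<bar> powr p + \<bar>b\<bar> powr p / p"
      using young_powr[OF p, of "\<bar>a\<bar>" "\<bar>b\<bar>"] by simp
    also have "\<dots> \<le> 1 * \<bar>a\<bar> powr p + \<bar>b\<bar> powr p / 1"
      using p by (intro add_mono mult_right_mono divide_left_mono) auto
    finally have "\<bar>a\<bar> powr (p - 1) * sgn a * b \<le> \<bar>a\<bar> powr p + \<bar>b\<bar> powr p" by simp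
    then have "(2 powr (p - 1) - 1) * (\<bar>a\<bar> powr (p - 1) * sgn a * b)
        \<le> (2 powr (p - 1) - 1) * (\<bar>a\<bar> powr p + \<bar>b\<bar> powr p)"
      using K by (intro mult_left_mono) auto
    with 1 show ?thesis by (simp add: algebra_simps)
  next
    case False
    have "\<bar>a\<bar> powr (p - 1) * sgn a * b = \<bar>a\<bar> powr (p - 1) * (sgn a * b)" by simp
    also have "\<dots> \<le> 0" by (rule mult_nonneg_nonpos) (use False in auto)
    finally have "(2 powr (p - 1) - 1) * (\<bar>a\<bar> powr (p - 1) * sgn a * b) \<le> 0"
      by (rule mult_nonneg_nonpos[rotated]) (use K in simp)
    then show ?thesis using abs_diff_powr_le[OF p, of a b] by linarith
  qed
qed

section \<open>Near-suprema over finitely many traces\<close>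

text \<open>A trace on which \<open>s\<close> has no values above \<open>L - \<eta>\<close> for some
  \<open>\<eta> > 0\<close> is excluded by every \<open>\<epsilon>\<close> below that gap. Finitely
  many traces admit a common \<open>\<epsilon>\<close>.\<close>

lemma finite_trace_sup:
  fixes s :: "'b \<Rightarrow> real"
  assumes "finite (tr ` F)"
  obtains \<epsilon> where "0 < \<epsilon>"
    "\<And>B \<eta>. B \<in> F \<Longrightarrow> L - \<epsilon> < s B \<Longrightarrow> 0 < \<eta> \<Longrightarrow> \<exists>A\<in>F. tr A = tr B \<and> L - \<eta> < s A"
proof -
  let ?P = "\<lambda>t \<epsilon>. (\<forall>B\<in>F. tr B = t \<longrightarrow> L - \<epsilon> < s B \<longrightarrow> (\<forall>\<eta>>0. \<exists>A\<in>F. tr A = t \<and> L - \<eta> < s A))"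
  have "\<forall>\<^sub>F \<epsilon> in at_right 0. ?P t \<epsilon>" for t
  proof (cases "\<forall>\<eta>>0. \<exists>A\<in>F. tr A = t \<and> L - \<eta> < s A")
    case False
    then obtain \<eta> where \<eta>: "0 < \<eta>" "\<And>A. A \<in> F \<Longrightarrow> tr A = t \<Longrightarrow> s A \<le> L - \<eta>"
      by (force simp: not_less)
    then show ?thesis
      unfolding eventually_at_right_field by (intro exI[of _ \<eta>]) force
  qed simp
  then have "\<forall>\<^sub>F \<epsilon> in at_right 0. (\<forall>t\<in>tr ` F. ?P t \<epsilon>) \<and> 0 < \<epsilon>"
    by (intro eventually_conj eventually_ball_finite[OF assms] eventually_at_right_less) simp
  then have "\<exists>\<epsilon>. (\<forall>t\<in>tr ` F. ?P t \<epsilon>) \<and> 0 < \<epsilon>"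
    by (rule eventually_happens'[rotated]) simp
  then show ?thesis using that by blast
qed

section \<open>Norms given by coordinates\<close>

text \<open>\<open>mass_le\<close> and \<open>mass_near\<close> together make
  \<open>norm x powr p\<close> the supremum of the sums over \<open>F\<close>. Nothing is known
  about \<open>c 0\<close>, whence \<open>F_pos\<close>.\<close>

locale coordinate_norm =
  fixes F :: "nat set set" and p :: real and e :: "nat \<Rightarrow> 'a::banach" and c :: "nat \<Rightarrow> 'a \<Rightarrow>\<^sub>L real"
  assumes p: "1 < p"
    and finite_F: "A \<in> F \<Longrightarrow> finite A"
    and F_pos: "A \<in> F \<Longrightarrow> A \<subseteq> {1..}"
    and dense: "closure (span (e ` {1..})) = UNIV"
    and coord_basis: "1 \<le> i \<Longrightarrow> 1 \<le> j \<Longrightarrow> c i (e j) = of_bool (i = j)"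
    and mass_le: "A \<in> F \<Longrightarrow> (\<Sum>i\<in>A. \<bar>c i x\<bar> powr p) \<le> norm x powr p"
    and mass_near: "0 \<le> r \<Longrightarrow> r < norm x \<Longrightarrow> \<exists>A\<in>F. r powr p < (\<Sum>i\<in>A. \<bar>c i x\<bar> powr p)"
begin

definition mass :: "nat set \<Rightarrow> 'a \<Rightarrow> real" where
  "mass A x = (\<Sum>i\<in>A. \<bar>c i x\<bar> powr p)"

lemma mass_le_1:
  assumes "A \<in> F" "norm x \<le> 1"
  shows "mass A x \<le> 1"
proof -
  have "mass A x \<le> norm x powr p" using mass_le[OF assms(1)] by (simp add: mass_def)
  also have "\<dots> \<le> 1 powr p" using assms p by (intro powr_mono2) auto
  finally show ?thesis by simp
qed

lemma norm_leI:
  assumes "0 \<le> r" "\<And>A. A \<in> F \<Longrightarrow> mass A x \<le> r powr p"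
  shows "norm x \<le> r"
proof (rule ccontr)
  assume "\<not> norm x \<le> r"
  then obtain A where "A \<in> F" "r powr p < mass A x"
    using mass_near[OF assms(1), of x] by (auto simp: mass_def)
  then show False using assms(2)[of A] by simp
qed

section \<open>Delta-points of the dual space\<close>

lemma no_delta_point_dual:
  fixes f :: "'a \<Rightarrow>\<^sub>L real"
  assumes f: "delta_point f"
  shows False
proof -
  have "norm f = 1" using f by (simp add: delta_point_def)
  have "\<exists>i\<ge>1. f (e i) \<noteq> 0"
  proof (rule ccontr)
    assume "\<not> ?thesis"
    then have "span (e ` {1..}) \<subseteq> {x. f x = 0}"
      by (intro span_minimal) (auto simp: subspace_def blinfun.add_right blinfun.scaleR_right)
    moreover have "closed {x. f x = 0}"
      by (intro closed_Collect_eq continuous_intros)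
    ultimately have "f x = 0" for x
      using closure_minimal[of "span (e ` {1..})" "{x. f x = 0}"] dense by auto
    then have "f = 0" by (intro blinfun_eqI) simp
    with \<open>norm f = 1\<close> show False by simp
  qed
  then obtain i where i: "1 \<le> i" "f (e i) \<noteq> 0" by blast
  define \<sigma> where "\<sigma> = sgn (f (e i))"
  have \<sigma>: "\<sigma> * \<sigma> = 1" "\<bar>\<sigma>\<bar> = 1" using i(2) by (auto simp: \<sigma>_def sgn_if)
  define u where "u = \<sigma> *\<^sub>R e i"
  define \<phi> where "\<phi> = f u"
  have \<phi>: "0 < \<phi>" using i(2) by (auto simp: \<phi>_def u_def \<sigma>_def blinfun.scaleR_right sgn_if)
  have cu: "c j (y + s *\<^sub>R u) = (if j = i then c j y + s * \<sigma> else c j y)" if "1 \<le> j" for j y s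
    using coord_basis[OF that i(1)] by (simp add: u_def blinfun.add_right blinfun.scaleR_right)
  \<comment> \<open>Solves \<open>(2 * s) powr p = s * \<phi> / 2\<close>, which is possible as
    \<open>p > 1\<close>: the mass added at coordinate \<open>i\<close> will be only half of the
    gain \<open>s * \<phi>\<close> of \<open>f\<close>.\<close>
  define s where "s = (\<phi> / 4) powr (1 / (p - 1)) / 2"
  have s: "0 < s" using \<phi> by (simp add: s_def)
  have "(2 * s) powr p = (2 * s) powr (p - 1) * (2 * s) powr 1"
    by (subst powr_add[symmetric]) simp
  also have "\<dots> = s * \<phi> / 2"
    using p \<phi> s by (simp add: s_def powr_powr)
  finally have s_eq: "(2 * s) powr p = s * \<phi> / 2" .
  define ev :: "('a \<Rightarrow>\<^sub>L real) \<Rightarrow>\<^sub>L real" where "ev = Blinfun (\<lambda>g :: 'a \<Rightarrow>\<^sub>L real. g u)"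
  have ev: "ev g = g u" for g :: "'a \<Rightarrow>\<^sub>L real"
    unfolding ev_def by (simp add: bounded_linear_Blinfun_apply blinfun.bounded_linear_left)
  \<comment> \<open>The first bound serves both \<open>\<bar>\<alpha>\<bar> \<le> s\<close> and
    \<open>r < f z\<close>; the second keeps \<open>2 - 2 * \<epsilon>\<close> nonnegative.\<close>
  define \<epsilon> where "\<epsilon> = min (s * \<phi> / 4) (1/4)"
  have \<epsilon>: "0 < \<epsilon>" "\<epsilon> \<le> s * \<phi> / 4" "\<epsilon> \<le> 1/4" using s \<phi> by (auto simp: \<epsilon>_def)
  obtain g :: "'a \<Rightarrow>\<^sub>L real" where g: "norm g \<le> 1" "\<phi> / 2 < g u" "2 - \<epsilon> \<le> norm (f - g)"
    using delta_point_halfspace[OF f, of "\<phi> / 2" ev \<epsilon>] \<phi> \<epsilon> by (auto simp: ev \<phi>_def)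
  obtain y where y: "norm y \<le> 1" "2 - 2 * \<epsilon> < (f - g) y"
    using blinfun_near_norm[of "2 - 2 * \<epsilon>" "f - g"] g(3) \<epsilon> by auto
  have le1: "\<bar>h z\<bar> \<le> 1" if "norm h \<le> 1" "norm z \<le> 1" for h :: "'a \<Rightarrow>\<^sub>L real" and z
    using norm_blinfun[of h z] mult_le_one[OF that(1) _ that(2)] by simp
  have fgy: "1 - 2 * \<epsilon> < f y" "g y < 2 * \<epsilon> - 1"
    using y(2) le1[of f y] le1[of g y] g(1) y(1) \<open>norm f = 1\<close> by (auto simp: minus_blinfun.rep_eq)
  define \<alpha> where "\<alpha> = \<sigma> * c i y"
  \<comment> \<open>Reflecting the \<open>i\<close>-th coordinate changes no mass, so
    \<open>y'\<close> stays in the unit ball.\<close>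
  define y' where "y' = y + (- 2 * \<alpha>) *\<^sub>R u"
  have "c i y' = - c i y" using cu[OF i(1), of y "- 2 * \<alpha>"] \<sigma>(1)
    by (simp add: y'_def \<alpha>_def mult.assoc)
  then have "\<bar>c j y'\<bar> = \<bar>c j y\<bar>" if "1 \<le> j" for j
    using cu[OF that, of y "- 2 * \<alpha>"] by (cases "j = i") (auto simp: y'_def)
  then have "mass A y' = mass A y" if "A \<in> F" for A
    unfolding mass_def using F_pos[OF that] by (intro sum.cong) auto
  then have "norm y' \<le> 1"
    using mass_le_1 y(1) by (intro norm_leI) auto
  then have "f y' \<le> 1" "- 1 \<le> g y'"
    using le1[of f y'] le1[of g y'] g(1) \<open>norm f = 1\<close> by auto
  \<comment> \<open>\<open>f y\<close> is nearly maximal and \<open>g y\<close> nearly minimal,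
    while both functionals are positive at \<open>u\<close>: \<open>f\<close> forbids a markedly
    negative \<open>\<alpha>\<close>, \<open>g\<close> a markedly positive one.\<close>
  then have "- 2 * \<alpha> * \<phi> \<le> 2 * \<epsilon>" "2 * (\<alpha> * g u) \<le> 2 * \<epsilon>"
    using fgy by (auto simp: y'_def \<phi>_def blinfun.diff_right blinfun.scaleR_right)
  moreover have "\<alpha> * \<phi> \<le> 2 * (\<alpha> * g u)" if "0 \<le> \<alpha>"
    using mult_left_mono[OF _ that, of "\<phi>/2" "g u"] g(2) by auto
  ultimately have "\<bar>\<alpha>\<bar> * \<phi> \<le> s * \<phi>"
    using \<epsilon> by (cases "0 \<le> \<alpha>") auto
  then have \<alpha>: "\<bar>\<alpha>\<bar> \<le> s" using \<phi> by simp
  define z where "z = y + s *\<^sub>R u"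
  \<comment> \<open>\<open>r\<close> separates two estimates: it lies below \<open>f z\<close>,
    hence below \<open>norm z\<close>, yet no mass of \<open>z\<close> exceeds \<open>r\<close>, and
    \<open>r \<le> r powr p\<close>.\<close>
  define r where "r = 1 + s * \<phi> / 2"
  have r: "1 < r" using s \<phi> by (simp add: r_def)
  have "r < f z"
    using fgy(1) \<epsilon>(2) by (simp add: z_def r_def \<phi>_def blinfun.add_right blinfun.scaleR_right)
  also have "f z \<le> norm z" using norm_blinfun[of f z] \<open>norm f = 1\<close> by simp
  finally obtain A where A: "A \<in> F" "r powr p < mass A z"
    using mass_near[of r z] r by (auto simp: mass_def)
  have "\<bar>c i z\<bar> \<le> \<bar>c i y\<bar> + s"
    using cu[OF i(1), of y s] \<sigma>(2) s by (simp add: z_def abs_mult abs_triangle_ineq[THEN order_trans])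
  also have "\<dots> \<le> 2 * s" using \<alpha> \<sigma>(2) by (simp add: \<alpha>_def abs_mult)
  finally have ci: "\<bar>c i z\<bar> powr p \<le> (2 * s) powr p" using p by (intro powr_mono2) auto
  have "\<bar>c j z\<bar> powr p \<le> \<bar>c j y\<bar> powr p + (if j = i then (2 * s) powr p else 0)" if "j \<in> A" for j
    using cu[of j y s] F_pos[OF A(1)] that ci by (auto simp: z_def intro: add_increasing)
  then have "mass A z \<le> (\<Sum>j\<in>A. \<bar>c j y\<bar> powr p + (if j = i then (2 * s) powr p else 0))"
    unfolding mass_def by (intro sum_mono)
  also have "\<dots> \<le> mass A y + (2 * s) powr p"
    using finite_F[OF A(1)] by (simp add: sum.distrib mass_def)
  also have "\<dots> \<le> r" using mass_le_1[OF A(1) y(1)] by (simp add: r_def s_eq)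
  also have "r \<le> r powr p" using powr_mono[of 1 p r] p r by simp
  finally show False using A(2) by simp
qed

section \<open>Delta-points of the space itself\<close>

text \<open>Some \<open>z\<close> in the span is close to \<open>x\<close>. Beyond the finite
  support of \<open>z\<close>, the mass of \<open>x\<close> is that of the small vector
  \<open>x - z\<close>.\<close>

lemma mass_tail:
  assumes "0 < \<epsilon>"
  obtains N where "\<And>A. A \<in> F \<Longrightarrow> mass (A - {1..N}) x \<le> \<epsilon>"
proof -
  define d where "d = \<epsilon> powr (1 / p)"
  have d: "0 < d" "d powr p = \<epsilon>" using assms p by (auto simp: d_def powr_powr)
  have "x \<in> closure (span (e ` {1..}))" using dense by simp
  then obtain z where z: "z \<in> span (e ` {1..})" "dist z x < d"
    unfolding closure_approachable using d(1) by blast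
  obtain T u where T: "finite T" "T \<subseteq> e ` {1..}" "z = (\<Sum>a\<in>T. u a *\<^sub>R a)"
    using z(1) unfolding span_explicit by blast
  then obtain J where J: "finite J" "J \<subseteq> {1..}" "T = e ` J"
    using finite_subset_image[OF T(1,2)] by blast
  define N where "N = Max (insert 0 J)"
  have "c i z = 0" if "N < i" for i
  proof -
    have "i \<notin> J" using that J(1) by (auto simp: N_def)
    have "c i (u a *\<^sub>R a) = 0" if a: "a \<in> T" for a
    proof -
      obtain j where j: "j \<in> J" "a = e j" using a J(3) by blast
      then have "1 \<le> j" "i \<noteq> j" using \<open>i \<notin> J\<close> J(2) by auto
      then show ?thesis
        using coord_basis[of i j] \<open>N < i\<close> j by (simp add: blinfun.scaleR_right)
    qed
    then show ?thesis by (simp add: T(3) blinfun.sum_right)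
  qed
  then have "mass (A - {1..N}) x \<le> \<epsilon>" if A: "A \<in> F" for A
  proof -
    have "mass (A - {1..N}) x = mass (A - {1..N}) (x - z)"
      unfolding mass_def using F_pos[OF A] \<open>\<And>i. N < i \<Longrightarrow> c i z = 0\<close>
      by (intro sum.cong) (auto simp: blinfun.diff_right)
    also have "\<dots> \<le> mass A (x - z)"
      unfolding mass_def using finite_F[OF A] by (intro sum_mono2) auto
    also have "\<dots> \<le> norm (x - z) powr p" using mass_le[OF A] by (simp add: mass_def)
    also have "\<dots> \<le> d powr p"
      using z(2) p by (intro powr_mono2) (auto simp: dist_norm norm_minus_commute)
    finally show ?thesis using d by simp
  qed
  then show ?thesis using that by blast
qed

text \<open>The unnormalised duality map of \<open>\<ell>\<^sub>p(A)\<close>.\<close>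

definition dual_map :: "'a \<Rightarrow> nat set \<Rightarrow> 'a \<Rightarrow>\<^sub>L real" where
  "dual_map x A = (\<Sum>i\<in>A. (\<bar>c i x\<bar> powr (p - 1) * sgn (c i x)) *\<^sub>R c i)"

lemma dual_map_apply: "dual_map x A y = (\<Sum>i\<in>A. \<bar>c i x\<bar> powr (p - 1) * sgn (c i x) * c i y)"
  by (simp add: dual_map_def blinfun.sum_left scaleR_blinfun.rep_eq)

lemma dual_map_self: "dual_map x A x = mass A x"
proof -
  have "\<bar>a\<bar> powr (p - 1) * sgn a * a = \<bar>a\<bar> powr p" for a :: real
    by (cases "a = 0") (simp_all add: powr_diff sgn_if)
  then show ?thesis by (simp add: dual_map_apply mass_def)
qed

text \<open>Young's inequality in each coordinate. Where \<open>x\<close> has mass well below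
  \<open>1\<close>, this keeps the value well below \<open>1\<close> for every \<open>y\<close> in
  the ball.\<close>

lemma dual_map_le: "dual_map x A y \<le> (1 - 1 / p) * mass A x + mass A y / p"
proof -
  have "\<bar>a\<bar> powr (p - 1) * sgn a * b \<le> (1 - 1 / p) * \<bar>a\<bar> powr p + \<bar>b\<bar> powr p / p" for a b :: real
  proof -
    have "\<bar>a\<bar> powr (p - 1) * sgn a * b \<le> \<bar>a\<bar> powr (p - 1) * \<bar>b\<bar>"
      unfolding mult.assoc by (intro mult_left_mono sgn_mult_le) simp
    then show ?thesis using young_powr[OF p, of "\<bar>a\<bar>" "\<bar>b\<bar>"] by simp
  qed
  then have "dual_map x A y \<le> (\<Sum>i\<in>A. (1 - 1 / p) * \<bar>c i x\<bar> powr p + \<bar>c i y\<bar> powr p / p)"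
    unfolding dual_map_apply by (intro sum_mono)
  also have "\<dots> = (1 - 1 / p) * mass A x + mass A y / p"
    unfolding mass_def sum.distrib sum_distrib_left sum_divide_distrib ..
  finally show ?thesis .
qed

lemma dual_map_le_1:
  assumes "A \<in> F" "norm x \<le> 1" "norm y \<le> 1"
  shows "dual_map x A y \<le> 1"
proof -
  have "dual_map x A y \<le> (1 - 1 / p) * mass A x + mass A y / p" by (rule dual_map_le)
  also have "\<dots> \<le> (1 - 1 / p) * 1 + 1 / p"
    using mass_le_1 assms p by (intro add_mono mult_left_mono divide_right_mono) auto
  finally show ?thesis by simp
qed

text \<open>The gaps \<open>?g i\<close> are nonnegative, and since both masses are at most
  \<open>1\<close> their sum over \<open>B\<close> is below \<open>\<gamma>\<close>. Hence so is
  their sum over any part \<open>t\<close>, where \<open>powr_antipodal_gap\<close> applies.\<close>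

lemma antipodal_masses:
  assumes B: "B \<in> F" and x: "norm x \<le> 1" and y: "norm y \<le> 1"
    and gap: "2 powr p - \<gamma> < mass B (x - y)"
  shows "1 - \<gamma> < mass B x"
    and "t \<subseteq> B \<Longrightarrow> (2 powr (p - 1) - 1) * dual_map x t y \<le> \<gamma>"
proof -
  let ?K = "2 powr (p - 1) :: real"
  let ?g = "\<lambda>i. ?K * (\<bar>c i x\<bar> powr p + \<bar>c i y\<bar> powr p) - \<bar>c i x - c i y\<bar> powr p"
  have K: "1 < ?K" "2 powr p = 2 * ?K" using p by (simp, simp add: powr_diff)
  have g0: "0 \<le> ?g i" for i using abs_diff_powr_le[OF p, of "c i x" "c i y"] by simp
  have sum: "(\<Sum>i\<in>B. ?g i) = ?K * (mass B x + mass B y) - mass B (x - y)"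
    by (simp add: mass_def sum_subtractf sum.distrib sum_distrib_left[symmetric] blinfun.diff_right)
  have my: "mass B x \<le> 1" "mass B y \<le> 1" using mass_le_1 B x y by auto
  have "?K * mass B y \<le> ?K" "?K * mass B x \<le> ?K" using my K by auto
  moreover have "0 \<le> (\<Sum>i\<in>B. ?g i)" using g0 by (intro sum_nonneg)
  ultimately have s: "?K * (1 - mass B x) < \<gamma>" "(\<Sum>i\<in>B. ?g i) < \<gamma>"
    using gap K(2) sum[unfolded distrib_left[of ?K "mass B x"]]
    unfolding right_diff_distrib[of ?K 1] by linarith+
  have "1 - mass B x \<le> ?K * (1 - mass B x)"
    using mult_right_mono[of 1 ?K "1 - mass B x"] my K by simp
  then show "1 - \<gamma> < mass B x" using s by simp
  assume t: "t \<subseteq> B"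
  have "(?K - 1) * dual_map x t y \<le> (\<Sum>i\<in>t. ?g i)"
    unfolding dual_map_apply sum_distrib_left by (intro sum_mono powr_antipodal_gap p)
  also have "\<dots> \<le> (\<Sum>i\<in>B. ?g i)" using g0 t finite_F[OF B] by (intro sum_mono2) auto
  finally show "(?K - 1) * dual_map x t y \<le> \<gamma>" using s by simp
qed

lemma no_delta_point:
  fixes x :: 'a
  assumes x: "delta_point x"
  shows False
proof -
  have nx: "norm x = 1" using x by (simp add: delta_point_def)
  obtain N where N: "\<And>A. A \<in> F \<Longrightarrow> mass (A - {1..N}) x \<le> 1 / 2"
    using mass_tail[of "1/2" x] by auto
  define tr where "tr A = A \<inter> {1..N}" for A
  have fin: "finite (tr ` F)"
    by (rule finite_subset[of _ "Pow {1..N}"]) (auto simp: tr_def)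
  obtain \<epsilon> where \<epsilon>: "0 < \<epsilon>"
    "\<And>B \<eta>. B \<in> F \<Longrightarrow> 1 - \<epsilon> < mass B x \<Longrightarrow> 0 < \<eta> \<Longrightarrow> \<exists>A\<in>F. tr A = tr B \<and> 1 - \<eta> < mass A x"
    using finite_trace_sup[OF fin, of 1 "\<lambda>A. mass A x"] by auto
  \<comment> \<open>The traces of sets whose mass of \<open>x\<close> comes arbitrarily close to
    \<open>1\<close>; by the choice of \<open>\<epsilon>\<close>, any set of mass above
    \<open>1 - \<epsilon>\<close> has its trace here.\<close>
  define T where "T = {t \<in> tr ` F. \<forall>\<eta>>0. \<exists>A\<in>F. tr A = t \<and> 1 - \<eta> < mass A x}"
  have "finite T" using fin by (simp add: T_def)
  \<comment> \<open>The deficit of a tail on which \<open>x\<close> has mass at most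
    \<open>1/2\<close>: \<open>(1 - 1/p) * (1/2) + 1/p = 1 - \<kappa>\<close>.\<close>
  define \<kappa> where "\<kappa> = (1 - 1 / p) / 2"
  have \<kappa>: "0 < \<kappa>" using p by (simp add: \<kappa>_def)
  \<comment> \<open>The total loss over \<open>T\<close> stays strictly below
    \<open>\<kappa> / 2\<close>; the \<open>+ 1\<close> also covers an empty \<open>T\<close>, which
    is ruled out only by \<open>tr B\<close> below.\<close>
  define \<eta> where "\<eta> = \<kappa> / (2 * (card T + 1))"
  have \<eta>: "0 < \<eta>" using \<kappa> by (simp add: \<eta>_def)
  have card\<eta>: "real (card T) * \<eta> < \<kappa> / 2" using \<kappa> by (simp add: \<eta>_def field_simps)
  have "\<forall>t\<in>T. \<exists>A\<in>F. tr A = t \<and> 1 - \<eta> < mass A x" using \<eta> by (simp add: T_def)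
  then obtain a where a: "\<And>t. t \<in> T \<Longrightarrow> a t \<in> F" "\<And>t. t \<in> T \<Longrightarrow> tr (a t) = t"
    "\<And>t. t \<in> T \<Longrightarrow> 1 - \<eta> < mass (a t) x" by metis
  define h where "h = (\<Sum>t\<in>T. dual_map x (a t))"
  have h: "h y = (\<Sum>t\<in>T. dual_map x (a t) y)" for y
    by (simp add: h_def blinfun.sum_left)
  have "(\<Sum>t\<in>T. 1 - \<eta>) \<le> h x"
    unfolding h dual_map_self using a(3) by (intro sum_mono) (auto intro: less_imp_le)
  then have hx: "real (card T) - \<kappa> / 2 < h x" using card\<eta> by (simp add: algebra_simps)
  \<comment> \<open>The three bounds put the trace of \<open>B\<close> into \<open>T\<close>, keep
    \<open>2 powr p - \<gamma>\<close> nonnegative, and bound \<open>dual_map x t y\<close> by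
    \<open>\<kappa> / 2\<close>.\<close>
  define \<gamma> where "\<gamma> = min (min \<epsilon> 1) ((2 powr (p - 1) - 1) * (\<kappa> / 2))"
  have K: "1 < 2 powr (p - 1)" using p by simp
  have \<gamma>: "0 < \<gamma>" "\<gamma> \<le> \<epsilon>" "\<gamma> \<le> 1" "\<gamma> \<le> (2 powr (p - 1) - 1) * (\<kappa> / 2)"
    using \<epsilon>(1) K \<kappa> by (auto simp: \<gamma>_def)
  have "1 \<le> 2 powr p" using p by (simp add: ge_one_powr_ge_zero)
  define r where "r = (2 powr p - \<gamma>) powr (1 / p)"
  have r: "0 \<le> r" "r powr p = 2 powr p - \<gamma>"
    using p \<gamma>(3) \<open>1 \<le> 2 powr p\<close> by (auto simp: r_def powr_powr)
  have "r < 2"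
  proof (rule ccontr)
    assume "\<not> r < 2"
    then have "2 powr p \<le> r powr p" using p by (intro powr_mono2) auto
    then show False using r \<gamma>(1) by simp
  qed
  obtain y where y: "norm y \<le> 1" "real (card T) - \<kappa> / 2 < h y" "2 - (2 - r) / 2 \<le> norm (x - y)"
    using delta_point_halfspace[OF x hx, of "(2 - r) / 2"] \<open>r < 2\<close> by auto
  have "r < norm (x - y)" using y(3) \<open>r < 2\<close> by (simp add: field_simps)
  then obtain B where B: "B \<in> F" "2 powr p - \<gamma> < mass B (x - y)"
    using mass_near[OF r(1)] r(2) by (auto simp: mass_def)
  note anti = antipodal_masses[OF B(1) _ y(1) B(2)]
  have "1 - \<epsilon> < mass B x" using anti(1) nx \<gamma>(2) by simp
  then have tT: "tr B \<in> T" using \<epsilon>(2)[OF B(1)] B(1) by (auto simp: T_def)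
  define t where "t = tr B"
  let ?A = "a t"
  have A: "?A \<in> F" "tr ?A = t" using a tT by (auto simp: t_def)
  have "(2 powr (p - 1) - 1) * dual_map x t y \<le> (2 powr (p - 1) - 1) * (\<kappa> / 2)"
    using anti(2)[of t] nx \<gamma>(4) by (simp add: t_def tr_def)
  then have 1: "dual_map x t y \<le> \<kappa> / 2" using K by simp
  have "mass (?A - {1..N}) y \<le> mass ?A y"
    unfolding mass_def using finite_F[OF A(1)] by (intro sum_mono2) auto
  also have "\<dots> \<le> 1" using mass_le_1 A(1) y(1) by blast
  finally have "dual_map x (?A - {1..N}) y \<le> (1 - 1 / p) * (1 / 2) + 1 / p"
    using N[OF A(1)] p
    by (intro order_trans[OF dual_map_le] add_mono mult_left_mono divide_right_mono) auto
  also have "\<dots> = 1 - \<kappa>" by (simp add: \<kappa>_def field_simps)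
  finally have 2: "dual_map x (?A - {1..N}) y \<le> 1 - \<kappa>" .
  \<comment> \<open>\<open>?A\<close> and \<open>B\<close> need only share the trace
    \<open>t\<close>: antipodality on \<open>B\<close> controls this part, the small tail of
    \<open>x\<close> controls the rest of \<open>?A\<close>.\<close>
  have "dual_map x ?A y = dual_map x (?A \<inter> {1..N}) y + dual_map x (?A - {1..N}) y"
    unfolding dual_map_apply by (rule sum.Int_Diff) (rule finite_F[OF A(1)])
  moreover have "?A \<inter> {1..N} = t" using A(2) by (simp only: tr_def)
  ultimately have 3: "dual_map x ?A y \<le> 1 - \<kappa> / 2" using 1 2 by simp
  \<comment> \<open>One summand is at most \<open>1 - \<kappa> / 2\<close> and the others at most
    \<open>1\<close>, which contradicts the half-space condition on \<open>y\<close>.\<close>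
  have "h y = dual_map x ?A y + (\<Sum>t\<in>T - {t}. dual_map x (a t) y)"
    unfolding h t_def by (rule sum.remove[OF \<open>finite T\<close> tT])
  also have "(\<Sum>t\<in>T - {t}. dual_map x (a t) y) \<le> (\<Sum>t\<in>T - {t}. 1)"
    using a(1) nx y(1) by (intro sum_mono dual_map_le_1) auto
  also have "\<dots> = real (card T) - 1"
    using \<open>finite T\<close> tT card_gt_0_iff[of T] by (auto simp: t_def of_nat_diff Suc_le_eq)
  finally show False using 3 y(2) by simp
qed

end

section \<open>Coordinates on the completion\<close>

text \<open>Coordinates on the span have norm at most \<open>1\<close> because singletons belong to
  \<open>\<A>\<close>, so they extend by density. Finite sets capture the norm: vectors of the span
  have finite support and \<open>\<A>\<close> is hereditary.\<close>

lemma h_space_coordinates: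
  fixes e :: "nat \<Rightarrow> 'a::banach"
  assumes ad: "adequate \<A>" and p: "1 < p" and h: "is_h_space \<A> p e"
  obtains c where "coordinate_norm {A \<in> \<A>. finite A} p e c"
proof -
  let ?V = "span (e ` {1..})"
  have dense: "closure ?V = UNIV" using h by (simp add: is_h_space_def)
  have norm_eq: "norm (\<Sum>i=1..n. a i *\<^sub>R e i) = c00_norm \<A> p n a" for n a
    using h by (simp add: is_h_space_def)
  have hered: "B \<in> \<A>" if "A \<in> \<A>" "B \<subseteq> A" for A B
    using ad that by (auto simp: adequate_def)
  have pos: "A \<subseteq> {1..}" if "A \<in> \<A>" for A
    using ad that by (auto simp: adequate_def)
  have ne: "\<A> \<noteq> {}" using ad by (auto simp: adequate_def)
  have lb: "(\<Sum>i\<in>A \<inter> {1..n}. \<bar>a i\<bar> powr p) powr (1 / p) \<le> norm (\<Sum>i=1..n. a i *\<^sub>R e i)"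
    if "A \<in> \<A>" for A n a
    unfolding norm_eq c00_norm_def using that bdd_above_c00_norm[of p a n \<A>] p
    by (intro cSUP_upper) auto
  have coef_le: "\<bar>a i\<bar> \<le> norm (\<Sum>i=1..n. a i *\<^sub>R e i)" if "1 \<le> i" "i \<le> n" for a i n
  proof -
    have "{i} \<in> \<A>" using ad that by (auto simp: adequate_def)
    then show ?thesis using lb[of "{i}" a n] that p by (simp add: powr_powr)
  qed
  \<comment> \<open>A vector supported on a member \<open>A\<close> carries its full
    \<open>p\<close>-norm: \<open>A\<close> attains it and any other set sees only part of the
    support.\<close>
  have norm_member: "norm (\<Sum>i\<in>A. a i *\<^sub>R e i) = (\<Sum>i\<in>A. \<bar>a i\<bar> powr p) powr (1 / p)"
    if A: "A \<in> \<A>" "finite A" for A a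
  proof -
    obtain n where n: "A \<subseteq> {1..n}" using A(2) pos[OF A(1)]
      by (metis Max_ge atLeastAtMost_iff atLeast_iff subset_iff)
    define b where "b i = (if i \<in> A then a i else 0)" for i
    have "(\<Sum>i\<in>A. a i *\<^sub>R e i) = (\<Sum>i=1..n. b i *\<^sub>R e i)"
      using n by (intro sum.mono_neutral_cong_left) (auto simp: b_def)
    then have 1: "norm (\<Sum>i\<in>A. a i *\<^sub>R e i) = norm (\<Sum>i=1..n. b i *\<^sub>R e i)" by simp
    have "(\<Sum>i\<in>B \<inter> {1..n}. \<bar>b i\<bar> powr p) powr (1 / p) \<le> (\<Sum>i\<in>A. \<bar>a i\<bar> powr p) powr (1 / p)" for B
    proof (intro powr_mono2 sum_nonneg)
      have "(\<Sum>i\<in>B \<inter> {1..n}. \<bar>b i\<bar> powr p) = (\<Sum>i\<in>B \<inter> {1..n} \<inter> A. \<bar>a i\<bar> powr p)"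
        by (intro sum.mono_neutral_cong_right) (auto simp: b_def)
      also have "\<dots> \<le> (\<Sum>i\<in>A. \<bar>a i\<bar> powr p)"
        using A(2) by (intro sum_mono2) auto
      finally show "(\<Sum>i\<in>B \<inter> {1..n}. \<bar>b i\<bar> powr p) \<le> (\<Sum>i\<in>A. \<bar>a i\<bar> powr p)" .
    qed (use p in auto)
    then have "norm (\<Sum>i=1..n. b i *\<^sub>R e i) \<le> (\<Sum>i\<in>A. \<bar>a i\<bar> powr p) powr (1 / p)"
      unfolding norm_eq c00_norm_def using ne by (intro cSUP_least) auto
    moreover have "A \<inter> {1..n} = A" using n by blast
    then have "(\<Sum>i\<in>A. \<bar>a i\<bar> powr p) powr (1 / p) \<le> norm (\<Sum>i=1..n. b i *\<^sub>R e i)"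
      using lb[OF A(1), of b n] by (simp add: b_def)
    ultimately show ?thesis using 1 by simp
  qed
  have span_sum: "\<exists>n a. x = (\<Sum>i=1..n. a i *\<^sub>R e i)" if x: "x \<in> ?V" for x
    using x
  proof (induction rule: span_induct_alt)
    case base
    show ?case by (rule exI[of _ 0]) simp
  next
    case (step r x y)
    then obtain i n a where i: "x = e i" "1 \<le> i" and y: "y = (\<Sum>i=1..n. a i *\<^sub>R e i)" by auto
    define b where "b j = (if j \<le> n then a j else 0) + (if j = i then r else 0)" for j
    have "y = (\<Sum>j=1..max n i. (if j \<le> n then a j else 0) *\<^sub>R e j)"
      unfolding y by (intro sum.mono_neutral_cong_left) auto
    moreover have "r *\<^sub>R x = (\<Sum>j=1..max n i. (if j = i then r else 0) *\<^sub>R e j)"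
      using i by (simp add: if_distrib[of "\<lambda>t. t *\<^sub>R _"] cong: if_cong)
    ultimately have "r *\<^sub>R x + y = (\<Sum>j=1..max n i. b j *\<^sub>R e j)"
      by (simp add: b_def scaleR_add_left sum.distrib add.commute)
    then show ?case by blast
  qed
  have coef_zero: "a j = 0" if J: "finite J" "J \<subseteq> {1..}" "(\<Sum>i\<in>J. a i *\<^sub>R e i) = 0" "j \<in> J" for J a j
  proof -
    obtain n where n: "J \<subseteq> {1..n}" using J(1,2)
      by (metis Max_ge atLeastAtMost_iff atLeast_iff subset_iff)
    define b where "b i = (if i \<in> J then a i else 0)" for i
    have "(\<Sum>i=1..n. b i *\<^sub>R e i) = 0"
      unfolding J(3)[symmetric] using n
      by (intro sum.mono_neutral_cong_right) (auto simp: b_def)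
    then show ?thesis using coef_le[of j n b] n J(4) by (auto simp: b_def)
  qed
  have inj: "inj_on e {1..}"
  proof (rule inj_onI, rule ccontr)
    fix i j :: nat assume ij: "i \<in> {1..}" "j \<in> {1..}" "e i = e j" "i \<noteq> j"
    then show False
      using coef_zero[of "{i, j}" "\<lambda>k. if k = i then 1 else - 1" i] by auto
  qed
  have indep: "independent (e ` {1..})"
    unfolding dependent_explicit
  proof clarify
    fix U u v assume U: "finite U" "U \<subseteq> e ` {1..}" "v \<in> U" "u v \<noteq> 0" "(\<Sum>v\<in>U. u v *\<^sub>R v) = 0"
    obtain J where J: "finite J" "J \<subseteq> {1..}" "U = e ` J"
      using finite_subset_image[OF U(1,2)] by blast
    obtain j where j: "j \<in> J" "v = e j" using U(3) J(3) by blast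
    have "(\<Sum>i\<in>J. u (e i) *\<^sub>R e i) = 0"
      using U(5) unfolding J(3) by (simp add: sum.reindex inj_on_subset[OF inj J(2)])
    then show False using coef_zero[OF J(1,2), of "\<lambda>i. u (e i)" j] j U(4) by simp
  qed
  have "\<exists>c :: 'a \<Rightarrow>\<^sub>L real. \<forall>j\<ge>1. c (e j) = of_bool (i = j)" if i: "1 \<le> i" for i
  proof -
    obtain \<phi> :: "'a \<Rightarrow> real" where \<phi>: "linear \<phi>" "\<And>x. x \<in> e ` {1..} \<Longrightarrow> \<phi> x = of_bool (x = e i)"
      using linear_independent_extend[OF indep, of "\<lambda>x. of_bool (x = e i)"] by blast
    interpret linear \<phi> by (fact \<phi>(1))
    have \<phi>e: "\<phi> (e j) = of_bool (i = j)" if "1 \<le> j" for j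
      using \<phi>(2)[of "e j"] that i inj by (auto simp: inj_on_def)
    have "\<bar>\<phi> x\<bar> \<le> norm x" if x: "x \<in> ?V" for x
    proof -
      obtain n a where xa: "x = (\<Sum>j=1..n. a j *\<^sub>R e j)" using span_sum[OF x] by blast
      have "\<phi> x = (\<Sum>j=1..n. a j * \<phi> (e j))" by (simp add: xa sum scale)
      also have "\<dots> = (\<Sum>j=1..n. if j = i then a j else 0)"
        by (intro sum.cong) (auto simp: \<phi>e)
      finally show ?thesis using coef_le[of i n a] i by (auto simp: xa)
    qed
    then obtain g :: "'a \<Rightarrow>\<^sub>L real" where g: "\<And>x. x \<in> ?V \<Longrightarrow> g x = \<phi> x"
      using dense_linear_extension[OF \<phi>(1) subspace_span dense] by metis
    have "g (e j) = of_bool (i = j)" if "1 \<le> j" for j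
      using g[of "e j"] \<phi>e[OF that] that by (simp add: span_base)
    then show ?thesis by blast
  qed
  then obtain c :: "nat \<Rightarrow> 'a \<Rightarrow>\<^sub>L real"
    where c: "\<And>i j. 1 \<le> i \<Longrightarrow> 1 \<le> j \<Longrightarrow> c i (e j) = of_bool (i = j)"
    by metis
  \<comment> \<open>For \<open>A\<close> in \<open>\<A>\<close>, the mass on \<open>A\<close> is the
    \<open>p\<close>-th power of the norm of this projection, so continuity and the triangle
    inequality become available.\<close>
  define P where "P A x = (\<Sum>i\<in>A. c i x *\<^sub>R e i)" for A x
  have P_norm: "norm (P A x) powr p = (\<Sum>i\<in>A. \<bar>c i x\<bar> powr p)" if "A \<in> \<A>" "finite A" for A x
    using norm_member[OF that, of "\<lambda>i. c i x"] p by (simp add: P_def powr_powr sum_nonneg)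
  have c_sum: "c i (\<Sum>j=1..n. a j *\<^sub>R e j) = (if i \<le> n then a i else 0)" if "1 \<le> i" for i n a
  proof -
    have "c i (\<Sum>j=1..n. a j *\<^sub>R e j) = (\<Sum>j=1..n. if i = j then a j else 0)"
      unfolding blinfun.sum_right using c that
      by (intro sum.cong) (auto simp: blinfun.scaleR_right)
    then show ?thesis using that by simp
  qed
  have P_le: "norm (P A x) \<le> norm x" if A: "A \<in> \<A>" "finite A" for A x
  proof -
    have "?V \<subseteq> {x. norm (P A x) \<le> norm x}"
    proof
      fix x assume "x \<in> ?V"
      then obtain n a where x: "x = (\<Sum>j=1..n. a j *\<^sub>R e j)" using span_sum by blast
      have cx: "c i x = (if i \<le> n then a i else 0)" if "i \<in> A" for i
        unfolding x by (rule c_sum) (use pos[OF A(1)] that in auto)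
      have "norm (P A x) = (\<Sum>i\<in>A. \<bar>c i x\<bar> powr p) powr (1 / p)"
        unfolding P_def by (rule norm_member[OF A])
      also have "(\<Sum>i\<in>A. \<bar>c i x\<bar> powr p) = (\<Sum>i\<in>A \<inter> {1..n}. \<bar>a i\<bar> powr p)"
        using pos[OF A(1)] A(2) by (intro sum.mono_neutral_cong_right) (auto simp: cx)
      finally show "x \<in> {x. norm (P A x) \<le> norm x}" using lb[OF A(1), of a n] x by simp
    qed
    moreover have "closed {x. norm (P A x) \<le> norm x}"
      unfolding P_def by (intro closed_Collect_le continuous_intros)
    ultimately show ?thesis using closure_minimal dense by blast
  qed
  have near: "\<exists>A\<in>{A \<in> \<A>. finite A}. r powr p < (\<Sum>i\<in>A. \<bar>c i x\<bar> powr p)"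
    if r: "0 \<le> r" "r < norm x" for r x
  proof -
    \<comment> \<open>One \<open>d\<close> pays for passing from \<open>x\<close> to
      \<open>z\<close>, one for returning from \<open>P B z\<close> to \<open>P B x\<close>; the
      third is slack.\<close>
    define d where "d = (norm x - r) / 3"
    have d: "0 < d" using r by (simp add: d_def)
    have "x \<in> closure ?V" using dense by simp
    then obtain z where z: "z \<in> ?V" "dist z x < d"
      unfolding closure_approachable using d by blast
    obtain n a where za: "z = (\<Sum>j=1..n. a j *\<^sub>R e j)" using span_sum[OF z(1)] by blast
    have "norm x - d < norm z"
      using z(2) norm_triangle_ineq2[of x z] by (simp add: dist_norm norm_minus_commute)
    then have "r + d < c00_norm \<A> p n a"
      using norm_eq[of a n] za r(2) by (simp add: d_def field_simps)
    then obtain A where A: "A \<in> \<A>" "r + d < (\<Sum>i\<in>A \<inter> {1..n}. \<bar>a i\<bar> powr p) powr (1 / p)"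
      unfolding c00_norm_def using less_cSUP_iff[OF ne bdd_above_c00_norm] p by auto
    define B where "B = A \<inter> {1..n}"
    have B: "B \<in> \<A>" "finite B" using hered[OF A(1)] by (auto simp: B_def)
    have cz: "c i z = a i" if "i \<in> B" for i
      using that c_sum[of i a n] by (simp add: B_def za)
    have "norm (P B z) = (\<Sum>i\<in>B. \<bar>a i\<bar> powr p) powr (1 / p)"
      unfolding P_def norm_member[OF B] by (simp add: cz)
    then have "r + d < norm (P B z)" using A(2) by (simp add: B_def)
    moreover have "P B z = P B x + P B (z - x)"
      by (simp add: P_def blinfun.diff_right scaleR_diff_left sum_subtractf)
    then have "norm (P B z) \<le> norm (P B x) + norm (z - x)"
      using norm_triangle_ineq[of "P B x" "P B (z - x)"] P_le[OF B, of "z - x"] by simp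
    ultimately have "r < norm (P B x)" using z(2) by (simp add: dist_norm)
    then have "r powr p < norm (P B x) powr p" using r p by (intro powr_less_mono2) auto
    then show ?thesis using B P_norm[OF B] by auto
  qed
  have "coordinate_norm {A \<in> \<A>. finite A} p e c"
  proof
    show "(\<Sum>i\<in>A. \<bar>c i x\<bar> powr p) \<le> norm x powr p" if "A \<in> {A \<in> \<A>. finite A}" for A x
      using that P_norm[of A x, symmetric] P_le[of A x] p by (auto intro!: powr_mono2)
  qed (use p pos dense c near in auto)
  then show ?thesis using that by blast
qed

theorem theorem3p1:
  fixes \<A> :: "nat set set" and p :: real and e :: "nat \<Rightarrow> 'a::banach"
  assumes "adequate \<A>" and "1 < p" and "is_h_space \<A> p e"
  shows "(\<nexists>x::'a. delta_point x) \<and> (\<nexists>f::'a \<Rightarrow>\<^sub>L real. delta_point f)"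
proof -
  obtain c where "coordinate_norm {A \<in> \<A>. finite A} p e c"
    using h_space_coordinates[OF assms] .
  then interpret coordinate_norm "{A \<in> \<A>. finite A}" p e c .
  show ?thesis using no_delta_point no_delta_point_dual by blast
qed

end
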